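(* Let $\mathcal A=((A,[\,,\,]_A),(V,\rho),T)$ and $\mathcal B=((B,[\,,\,]_B),(M,\nu_M),S)$ be relative Rota-Baxter Lie algebras over a field $k$, and let $\mathcal E:0\to\mathcal B\xrightarrow{(\mathfrak i,i)}\hat{\mathcal A}\xrightarrow{(\mathfrak p,p)}\mathcal A\to0$ be an abelian extension of $\mathcal A$ by $\mathcal B$ with a section $(\mathfrak s,s)$ of $(\mathfrak p,p)$. A pair $(d_{\mathcal A},d_{\mathcal B})\in\mathrm{Der}(\mathcal A)\times\mathrm{End}(\mathcal B)$ is inducible associated to $\mathcal E$ if and only if $(d_{\mathcal A},d_{\mathcal B})\in\mathfrak g(\mathcal A,\mathcal B)$ and $W((d_{\mathcal A},d_{\mathcal B}))=[0]$.
   Context: A relative Rota-Baxter Lie algebra is a triple $((A,[\,,\,]_A),(V,\rho),T)$ where $(A,[\,,\,]_A)$ is a Lie algebra, $\rho:A\to\mathfrak{gl}(V)$ is a representation of $A$ on the vector space $V$, and $T:V\to A$ is a linear map with $[T(u),T(v)]_A=T(\rho(T(u))v-\rho(T(v))u)$ for all $u,v\in V$. It is abelian if $[\,,\,]_A=0$ and $\rho=0$. A homomorphism from $((A,[\,,\,]_A),(V,\rho),T)$ to $((A',[\,,\,]_{A'}),(V',\rho'),T')$ is a pair $(\varphi,\phi)$ with $\varphi:A\to A'$ a Lie algebra homomorphism and $\phi:V\to V'$ linear such that $T'\phi=\varphi T$ and $\phi(\rho(x)v)=\rho'(\varphi(x))\phi(v)$. A derivation of $\mathcal A$ is a pair $d_{\mathcal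 A}=(d_A,d_V)$ of linear maps $d_A:A\to A$, $d_V:V\to V$ such that $d_A$ is a derivation of the Lie algebra $A$, $Td_V=d_AT$, and $d_V(\rho(x)v)=\rho(x)d_V(v)+\rho(d_A(x))v$; $\mathrm{Der}(\mathcal A)$ is the set of derivations. $\mathrm{End}(\mathcal B)$ is the set of pairs $d_{\mathcal B}=(d_B,d_M)$ of linear maps $d_B:B\to B$, $d_M:M\to M$. An abelian extension of $\mathcal A$ by $\mathcal B$, where $\mathcal B$ is abelian, is a relative Rota-Baxter Lie algebra $\hat{\mathcal A}=((\hat A,[\,,\,]_{\hat A}),(\hat V,\hat\rho),\hat T)$ with homomorphisms $(\mathfrak i,i):\mathcal B\to\hat{\mathcal A}$ and $(\mathfrak p,p):\hat{\mathcal A}\to\mathcal A$ such that $0\to B\xrightarrow{\mathfrak i}\hat A\xrightarrow{\mathfrak p}A\to0$ and $0\to M\xrightarrow{i}\hat V\xrightarrow{p}V\to0$ are exact. $B$ and $M$ are identified with their images. A section is a pair of linear maps $\mathfrak s:A\to\hat A$, $s:V\to\hat V$ with $\mathfrak p\mathfrak s=\mathrm{id}_A$, $ps=\mathrm{id}_V$. The induced maps are $\omega(x,y)=[\mathfrak s(x),\mathfrak s(y)]_{\hat A}-\mathfrak s([x,y]_A)\in B$, $\varpi(x,v)=\hat\rho(\mathfrak s(x))s(v)-s(\rho(x)v)\in M$, $\chi(v)=\hat T(s(v))-\mathfrak s(T(v))\in B$, $\mu(v)a=-\hat\rho(a)s(v)\in M$, $\rho_B(x)a=[\mathfrak s(x),a]_{\hat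 A}\in B$, $\rho_M(x)m=\hat\rho(\mathfrak s(x))m\in M$. $\mathfrak g(\mathcal A,\mathcal B)$ is the set of $(d_{\mathcal A},d_{\mathcal B})\in\mathrm{Der}(\mathcal A)\times\mathrm{End}(\mathcal B)$ such that for all $x\in A$, $a\in B$, $m\in M$, $v\in V$: $d_M(\rho_M(x)m)=\rho_M(x)d_M(m)+\rho_M(d_Ax)m$, $d_B(\rho_B(x)a)=\rho_B(x)d_B(a)+\rho_B(d_Ax)a$, $d_M(\mu(v)a)=\mu(d_Vv)a+\mu(v)d_B(a)$, $d_BS=Sd_M$. Cohomology (coefficients in $(M\xrightarrow{S}B,\rho_B,\rho_M,\mu)$): $\mathcal Z^2(\mathcal A,\mathcal B)$ is the space of $(f_B,f_M,\theta)\in\mathrm{Hom}(\wedge^2A,B)\oplus\mathrm{Hom}(A\otimes V,M)\oplus\mathrm{Hom}(V,B)$ such that for all $x,y,z\in A$, $v,v_1,v_2\in V$: $\rho_B(x)f_B(y,z)-\rho_B(y)f_B(x,z)+\rho_B(z)f_B(x,y)-f_B([x,y]_A,z)+f_B([x,z]_A,y)-f_B([y,z]_A,x)=0$; $-f_M([x,y]_A,v)+\mu(v)f_B(x,y)+\rho_M(x)f_M(y,v)-\rho_M(y)f_M(x,v)-f_M(y,\rho(x)v)+f_M(x,\rho(y)v)=0$; $\rho_B(Tv_1)\theta(v_2)-\rho_B(Tv_2)\theta(v_1)-S(\mu(v_1)\theta(v_2)-\mu(v_2)\theta(v_1))-\theta(\rho(Tv_1)v_2-\rho(Tv_2)v_1)+f_B(Tv_1,Tv_2)-S(f_M(Tv_1,v_2)-f_M(Tv_2,v_1))=0$.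 $\mathcal B^2(\mathcal A,\mathcal B)$ is the set of $((\delta\varphi)_B,(\delta\varphi)_M,h_T\varphi)$ with $\varphi_B:A\to B$, $\varphi_M:V\to M$ linear, $(\delta\varphi)_B(x,y)=\rho_B(x)\varphi_B(y)-\rho_B(y)\varphi_B(x)-\varphi_B([x,y]_A)$, $(\delta\varphi)_M(x,v)=-\mu(v)\varphi_B(x)+\rho_M(x)\varphi_M(v)-\varphi_M(\rho(x)v)$, $(h_T\varphi)(v)=-\varphi_B(Tv)+S\varphi_M(v)$. $\mathcal H^2=\mathcal Z^2/\mathcal B^2$. The Wells map $W:\mathfrak g(\mathcal A,\mathcal B)\to\mathcal H^2(\mathcal A,\mathcal B)$ sends $(d_{\mathcal A},d_{\mathcal B})$ to the class of $(d_B\omega-\omega(d_A\otimes\mathrm{id}_A)-\omega(\mathrm{id}_A\otimes d_A),\ d_M\varpi-\varpi(d_A\otimes\mathrm{id}_V)-\varpi(\mathrm{id}_A\otimes d_V),\ d_B\chi-\chi d_V)$. $\mathrm{Der}_{\mathcal B}(\hat{\mathcal A})$ is the set of derivations $(d_{\hat A},d_{\hat V})$ of $\hat{\mathcal A}$ with $d_{\hat A}(B)\subseteq B$, $d_{\hat V}(M)\subseteq M$. A pair $(d_{\mathcal A},d_{\mathcal B})\in\mathrm{Der}(\mathcal A)\times\mathrm{End}(\mathcal B)$ is inducible associated to $\mathcal E$ if there is $(d_{\hat A},d_{\hat V})\in\mathrm{Der}_{\mathcal B}(\hat{\mathcal A})$ with $d_{\mathcal A}=(\mathfrak pd_{\hat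 A}\mathfrak s,pd_{\hat V}s)$ and $d_{\mathcal B}=(d_{\hat A}|_B,d_{\hat V}|_M)$. *)

theory Defs
  imports Complex_Main "HOL-Library.Function_Algebras" "HOL-Library.Product_Plus"
begin

text \<open>
  Every vector space over the field \<open>'k\<close> is a whole type of class \<open>ab_group_add\<close> together with an
  explicit scalar multiplication. The locale predicate \<open>Vector_Spaces.linear\<close> includes that its
  domain and codomain are vector spaces for the given scalar multiplications.
\<close>

definition bilinear_map ::
  "('k::field \<Rightarrow> 'a::ab_group_add \<Rightarrow> 'a) \<Rightarrow> ('k \<Rightarrow> 'b::ab_group_add \<Rightarrow> 'b) \<Rightarrow>
   ('k \<Rightarrow> 'c::ab_group_add \<Rightarrow> 'c) \<Rightarrow> ('a \<Rightarrow> 'b \<Rightarrow> 'c) \<Rightarrow> bool"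
  where "bilinear_map sa sb sc f \<longleftrightarrow>
    (\<forall>x. Vector_Spaces.linear sb sc (f x)) \<and> (\<forall>y. Vector_Spaces.linear sa sc (\<lambda>x. f x y))"

definition lie_algebra ::
  "('k::field \<Rightarrow> 'a::ab_group_add \<Rightarrow> 'a) \<Rightarrow> ('a \<Rightarrow> 'a \<Rightarrow> 'a) \<Rightarrow> bool"
  where "lie_algebra sa br \<longleftrightarrow> vector_space sa \<and> bilinear_map sa sa sa br \<and>
    (\<forall>x. br x x = 0) \<and>
    (\<forall>x y z. br x (br y z) + br y (br z x) + br z (br x y) = 0)"

definition lie_representation ::
  "('k::field \<Rightarrow> 'a::ab_group_add \<Rightarrow> 'a) \<Rightarrow> ('a \<Rightarrow> 'a \<Rightarrow> 'a) \<Rightarrow>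
   ('k \<Rightarrow> 'v::ab_group_add \<Rightarrow> 'v) \<Rightarrow> ('a \<Rightarrow> 'v \<Rightarrow> 'v) \<Rightarrow> bool"
  where "lie_representation sa br sv rho \<longleftrightarrow> vector_space sv \<and> bilinear_map sa sv sv rho \<and>
    (\<forall>x y v. rho (br x y) v = rho x (rho y v) - rho y (rho x v))"

record ('k, 'a, 'v) rel_rb =
  alg_scale :: "'k \<Rightarrow> 'a \<Rightarrow> 'a"
  bracket :: "'a \<Rightarrow> 'a \<Rightarrow> 'a"
  mod_scale :: "'k \<Rightarrow> 'v \<Rightarrow> 'v"
  action :: "'a \<Rightarrow> 'v \<Rightarrow> 'v"
  rb_op :: "'v \<Rightarrow> 'a"

definition rel_rb_lie_algebra ::
  "('k::field, 'a::ab_group_add, 'v::ab_group_add) rel_rb \<Rightarrow> bool"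
  where "rel_rb_lie_algebra \<A> \<longleftrightarrow>
    lie_algebra (alg_scale \<A>) (bracket \<A>) \<and>
    lie_representation (alg_scale \<A>) (bracket \<A>) (mod_scale \<A>) (action \<A>) \<and>
    Vector_Spaces.linear (mod_scale \<A>) (alg_scale \<A>) (rb_op \<A>) \<and>
    (\<forall>u v. bracket \<A> (rb_op \<A> u) (rb_op \<A> v) =
       rb_op \<A> (action \<A> (rb_op \<A> u) v - action \<A> (rb_op \<A> v) u))"

definition rel_rb_abelian ::
  "('k::field, 'a::ab_group_add, 'v::ab_group_add) rel_rb \<Rightarrow> bool"
  where "rel_rb_abelian \<A> \<longleftrightarrow>
    (\<forall>x y. bracket \<A> x y = 0) \<and> (\<forall>x v. action \<A> x v = 0)"

definition rel_rb_hom ::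
  "('k::field, 'a::ab_group_add, 'v::ab_group_add) rel_rb \<Rightarrow>
   ('k, 'c::ab_group_add, 'w::ab_group_add) rel_rb \<Rightarrow> ('a \<Rightarrow> 'c) \<Rightarrow> ('v \<Rightarrow> 'w) \<Rightarrow> bool"
  where "rel_rb_hom \<A> \<A>' f g \<longleftrightarrow>
    Vector_Spaces.linear (alg_scale \<A>) (alg_scale \<A>') f \<and>
    (\<forall>x y. f (bracket \<A> x y) = bracket \<A>' (f x) (f y)) \<and>
    Vector_Spaces.linear (mod_scale \<A>) (mod_scale \<A>') g \<and>
    (\<forall>v. rb_op \<A>' (g v) = f (rb_op \<A> v)) \<and>
    (\<forall>x v. g (action \<A> x v) = action \<A>' (f x) (g v))"

definition Der ::
  "('k::field, 'a::ab_group_add, 'v::ab_group_add) rel_rb \<Rightarrow> (('a \<Rightarrow> 'a) \<times> ('v \<Rightarrow> 'v)) set"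
  where "Der \<A> = {(dA, dV).
    Vector_Spaces.linear (alg_scale \<A>) (alg_scale \<A>) dA \<and>
    (\<forall>x y. dA (bracket \<A> x y) = bracket \<A> (dA x) y + bracket \<A> x (dA y)) \<and>
    Vector_Spaces.linear (mod_scale \<A>) (mod_scale \<A>) dV \<and>
    (\<forall>v. rb_op \<A> (dV v) = dA (rb_op \<A> v)) \<and>
    (\<forall>x v. dV (action \<A> x v) = action \<A> x (dV v) + action \<A> (dA x) v)}"

definition End ::
  "('k::field, 'b::ab_group_add, 'm::ab_group_add) rel_rb \<Rightarrow> (('b \<Rightarrow> 'b) \<times> ('m \<Rightarrow> 'm)) set"
  where "End \<B> = {(dB, dM).
    Vector_Spaces.linear (alg_scale \<B>) (alg_scale \<B>) dB \<and>
    Vector_Spaces.linear (mod_scale \<B>) (mod_scale \<B>) dM}"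

text \<open>The middle term of an extension and its four structure maps.\<close>

record ('k, 'a, 'v, 'b, 'm, 'c, 'w) extension =
  total :: "('k, 'c, 'w) rel_rb"
  inc_alg :: "'b \<Rightarrow> 'c"
  inc_mod :: "'m \<Rightarrow> 'w"
  proj_alg :: "'c \<Rightarrow> 'a"
  proj_mod :: "'w \<Rightarrow> 'v"

definition abelian_extension ::
  "('k::field, 'a::ab_group_add, 'v::ab_group_add) rel_rb \<Rightarrow>
   ('k, 'b::ab_group_add, 'm::ab_group_add) rel_rb \<Rightarrow>
   ('k, 'a, 'v, 'b, 'm, 'c::ab_group_add, 'w::ab_group_add) extension \<Rightarrow> bool"
  where "abelian_extension \<A> \<B> \<E> \<longleftrightarrow>
    rel_rb_lie_algebra \<A> \<and> rel_rb_lie_algebra \<B> \<and> rel_rb_abelian \<B> \<and>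
    rel_rb_lie_algebra (total \<E>) \<and>
    rel_rb_hom \<B> (total \<E>) (inc_alg \<E>) (inc_mod \<E>) \<and>
    rel_rb_hom (total \<E>) \<A> (proj_alg \<E>) (proj_mod \<E>) \<and>
    inj (inc_alg \<E>) \<and> range (inc_alg \<E>) = {x. proj_alg \<E> x = 0} \<and> surj (proj_alg \<E>) \<and>
    inj (inc_mod \<E>) \<and> range (inc_mod \<E>) = {v. proj_mod \<E> v = 0} \<and> surj (proj_mod \<E>)"

definition is_section ::
  "('k::field, 'a::ab_group_add, 'v::ab_group_add) rel_rb \<Rightarrow>
   ('k, 'a, 'v, 'b::ab_group_add, 'm::ab_group_add, 'c::ab_group_add, 'w::ab_group_add) extension \<Rightarrow>
   ('a \<Rightarrow> 'c) \<Rightarrow> ('v \<Rightarrow> 'w) \<Rightarrow> bool"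
  where "is_section \<A> \<E> sA sV \<longleftrightarrow>
    Vector_Spaces.linear (alg_scale \<A>) (alg_scale (total \<E>)) sA \<and> proj_alg \<E> \<circ> sA = id \<and>
    Vector_Spaces.linear (mod_scale \<A>) (mod_scale (total \<E>)) sV \<and> proj_mod \<E> \<circ> sV = id"

text \<open>
  The kernel spaces are separate types, embedded by \<open>inc_alg\<close> and \<open>inc_mod\<close>. An element of the
  middle term lying in the image of an embedding is read back through \<open>inv\<close> of that embedding;
  for an abelian extension and a section, every argument of \<open>inv\<close> below lies in that image.
\<close>

definition omega ::
  "('k, 'a, 'v) rel_rb \<Rightarrow> ('k, 'a, 'v, 'b, 'm, 'c::ab_group_add, 'w) extension \<Rightarrow>
   ('a \<Rightarrow> 'c) \<Rightarrow> 'a \<Rightarrow> 'a \<Rightarrow> 'b"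
  where "omega \<A> \<E> sA x y =
    inv (inc_alg \<E>) (bracket (total \<E>) (sA x) (sA y) - sA (bracket \<A> x y))"

definition varpi ::
  "('k, 'a, 'v) rel_rb \<Rightarrow> ('k, 'a, 'v, 'b, 'm, 'c, 'w::ab_group_add) extension \<Rightarrow>
   ('a \<Rightarrow> 'c) \<Rightarrow> ('v \<Rightarrow> 'w) \<Rightarrow> 'a \<Rightarrow> 'v \<Rightarrow> 'm"
  where "varpi \<A> \<E> sA sV x v =
    inv (inc_mod \<E>) (action (total \<E>) (sA x) (sV v) - sV (action \<A> x v))"

definition chi ::
  "('k, 'a, 'v) rel_rb \<Rightarrow> ('k, 'a, 'v, 'b, 'm, 'c::ab_group_add, 'w) extension \<Rightarrow>
   ('a \<Rightarrow> 'c) \<Rightarrow> ('v \<Rightarrow> 'w) \<Rightarrow> 'v \<Rightarrow> 'b"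
  where "chi \<A> \<E> sA sV v =
    inv (inc_alg \<E>) (rb_op (total \<E>) (sV v) - sA (rb_op \<A> v))"

definition mu ::
  "('k, 'a, 'v, 'b, 'm, 'c, 'w::ab_group_add) extension \<Rightarrow> ('v \<Rightarrow> 'w) \<Rightarrow> 'v \<Rightarrow> 'b \<Rightarrow> 'm"
  where "mu \<E> sV v a = inv (inc_mod \<E>) (- action (total \<E>) (inc_alg \<E> a) (sV v))"

definition rho_B ::
  "('k, 'a, 'v, 'b, 'm, 'c, 'w) extension \<Rightarrow> ('a \<Rightarrow> 'c) \<Rightarrow> 'a \<Rightarrow> 'b \<Rightarrow> 'b"
  where "rho_B \<E> sA x a = inv (inc_alg \<E>) (bracket (total \<E>) (sA x) (inc_alg \<E> a))"

definition rho_M ::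
  "('k, 'a, 'v, 'b, 'm, 'c, 'w) extension \<Rightarrow> ('a \<Rightarrow> 'c) \<Rightarrow> 'a \<Rightarrow> 'm \<Rightarrow> 'm"
  where "rho_M \<E> sA x m = inv (inc_mod \<E>) (action (total \<E>) (sA x) (inc_mod \<E> m))"

definition compatible_pairs ::
  "('k::field, 'a::ab_group_add, 'v::ab_group_add) rel_rb \<Rightarrow>
   ('k, 'b::ab_group_add, 'm::ab_group_add) rel_rb \<Rightarrow>
   ('a \<Rightarrow> 'b \<Rightarrow> 'b) \<Rightarrow> ('a \<Rightarrow> 'm \<Rightarrow> 'm) \<Rightarrow> ('v \<Rightarrow> 'b \<Rightarrow> 'm) \<Rightarrow>
   ((('a \<Rightarrow> 'a) \<times> ('v \<Rightarrow> 'v)) \<times> (('b \<Rightarrow> 'b) \<times> ('m \<Rightarrow> 'm))) set"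
  where "compatible_pairs \<A> \<B> rB rM \<mu> = {((dA, dV), (dB, dM)).
    (dA, dV) \<in> Der \<A> \<and> (dB, dM) \<in> End \<B> \<and>
    (\<forall>x m. dM (rM x m) = rM x (dM m) + rM (dA x) m) \<and>
    (\<forall>x a. dB (rB x a) = rB x (dB a) + rB (dA x) a) \<and>
    (\<forall>v a. dM (\<mu> v a) = \<mu> (dV v) a + \<mu> v (dB a)) \<and>
    (\<forall>m. dB (rb_op \<B> m) = rb_op \<B> (dM m))}"

text \<open>
  Cochains are curried maps: an element of \<open>Hom(\<Lambda>\<^sup>2 A, B)\<close> is an alternating bilinear map and an
  element of \<open>Hom(A \<otimes> V, M)\<close> is a bilinear map.
\<close>

type_synonym ('a, 'v, 'b, 'm) cochain2 = "('a \<Rightarrow> 'a \<Rightarrow> 'b) \<times> ('a \<Rightarrow> 'v \<Rightarrow> 'm) \<times> ('v \<Rightarrow> 'b)"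

definition Z2 ::
  "('k::field, 'a::ab_group_add, 'v::ab_group_add) rel_rb \<Rightarrow>
   ('k, 'b::ab_group_add, 'm::ab_group_add) rel_rb \<Rightarrow>
   ('a \<Rightarrow> 'b \<Rightarrow> 'b) \<Rightarrow> ('a \<Rightarrow> 'm \<Rightarrow> 'm) \<Rightarrow> ('v \<Rightarrow> 'b \<Rightarrow> 'm) \<Rightarrow> ('a, 'v, 'b, 'm) cochain2 set"
  where "Z2 \<A> \<B> rB rM \<mu> = {(fB, fM, \<theta>).
    (let br = bracket \<A>; \<rho> = action \<A>; T = rb_op \<A>; S = rb_op \<B> in
      bilinear_map (alg_scale \<A>) (alg_scale \<A>) (alg_scale \<B>) fB \<and> (\<forall>x. fB x x = 0) \<and>
      bilinear_map (alg_scale \<A>) (mod_scale \<A>) (mod_scale \<B>) fM \<and>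
      Vector_Spaces.linear (mod_scale \<A>) (alg_scale \<B>) \<theta> \<and>
      (\<forall>x y z. rB x (fB y z) - rB y (fB x z) + rB z (fB x y)
         - fB (br x y) z + fB (br x z) y - fB (br y z) x = 0) \<and>
      (\<forall>x y v. - fM (br x y) v + \<mu> v (fB x y) + rM x (fM y v) - rM y (fM x v)
         - fM y (\<rho> x v) + fM x (\<rho> y v) = 0) \<and>
      (\<forall>v1 v2. rB (T v1) (\<theta> v2) - rB (T v2) (\<theta> v1)
         - S (\<mu> v1 (\<theta> v2) - \<mu> v2 (\<theta> v1))
         - \<theta> (\<rho> (T v1) v2 - \<rho> (T v2) v1)
         + fB (T v1) (T v2) - S (fM (T v1) v2 - fM (T v2) v1) = 0))}"

definition coboundary ::
  "('k, 'a, 'v) rel_rb \<Rightarrow> ('k, 'b::ab_group_add, 'm::ab_group_add) rel_rb \<Rightarrow>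
   ('a \<Rightarrow> 'b \<Rightarrow> 'b) \<Rightarrow> ('a \<Rightarrow> 'm \<Rightarrow> 'm) \<Rightarrow> ('v \<Rightarrow> 'b \<Rightarrow> 'm) \<Rightarrow>
   ('a \<Rightarrow> 'b) \<Rightarrow> ('v \<Rightarrow> 'm) \<Rightarrow> ('a, 'v, 'b, 'm) cochain2"
  where "coboundary \<A> \<B> rB rM \<mu> \<phi>B \<phi>M =
    (\<lambda>x y. rB x (\<phi>B y) - rB y (\<phi>B x) - \<phi>B (bracket \<A> x y),
     \<lambda>x v. - \<mu> v (\<phi>B x) + rM x (\<phi>M v) - \<phi>M (action \<A> x v),
     \<lambda>v. - \<phi>B (rb_op \<A> v) + rb_op \<B> (\<phi>M v))"

definition B2 ::
  "('k::field, 'a::ab_group_add, 'v::ab_group_add) rel_rb \<Rightarrow>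
   ('k, 'b::ab_group_add, 'm::ab_group_add) rel_rb \<Rightarrow>
   ('a \<Rightarrow> 'b \<Rightarrow> 'b) \<Rightarrow> ('a \<Rightarrow> 'm \<Rightarrow> 'm) \<Rightarrow> ('v \<Rightarrow> 'b \<Rightarrow> 'm) \<Rightarrow> ('a, 'v, 'b, 'm) cochain2 set"
  where "B2 \<A> \<B> rB rM \<mu> = {coboundary \<A> \<B> rB rM \<mu> \<phi>B \<phi>M | \<phi>B \<phi>M.
    Vector_Spaces.linear (alg_scale \<A>) (alg_scale \<B>) \<phi>B \<and>
    Vector_Spaces.linear (mod_scale \<A>) (mod_scale \<B>) \<phi>M}"

text \<open>
  The quotient \<open>Z2 / B2\<close>: classes are the equivalence classes of the relation \<open>cohomologous\<close> on
  \<open>Z2\<close>, where cochains are subtracted componentwise and pointwise.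
\<close>

definition cohomologous ::
  "('k::field, 'a::ab_group_add, 'v::ab_group_add) rel_rb \<Rightarrow>
   ('k, 'b::ab_group_add, 'm::ab_group_add) rel_rb \<Rightarrow>
   ('a \<Rightarrow> 'b \<Rightarrow> 'b) \<Rightarrow> ('a \<Rightarrow> 'm \<Rightarrow> 'm) \<Rightarrow> ('v \<Rightarrow> 'b \<Rightarrow> 'm) \<Rightarrow> ('a, 'v, 'b, 'm) cochain2 rel"
  where "cohomologous \<A> \<B> rB rM \<mu> = {(z, z'). z \<in> Z2 \<A> \<B> rB rM \<mu> \<and> z' \<in> Z2 \<A> \<B> rB rM \<mu> \<and>
    z - z' \<in> B2 \<A> \<B> rB rM \<mu>}"

definition H2 ::
  "('k::field, 'a::ab_group_add, 'v::ab_group_add) rel_rb \<Rightarrow>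
   ('k, 'b::ab_group_add, 'm::ab_group_add) rel_rb \<Rightarrow>
   ('a \<Rightarrow> 'b \<Rightarrow> 'b) \<Rightarrow> ('a \<Rightarrow> 'm \<Rightarrow> 'm) \<Rightarrow> ('v \<Rightarrow> 'b \<Rightarrow> 'm) \<Rightarrow> ('a, 'v, 'b, 'm) cochain2 set set"
  where "H2 \<A> \<B> rB rM \<mu> = Z2 \<A> \<B> rB rM \<mu> // cohomologous \<A> \<B> rB rM \<mu>"

definition cohomology_class ::
  "('k::field, 'a::ab_group_add, 'v::ab_group_add) rel_rb \<Rightarrow>
   ('k, 'b::ab_group_add, 'm::ab_group_add) rel_rb \<Rightarrow>
   ('a \<Rightarrow> 'b \<Rightarrow> 'b) \<Rightarrow> ('a \<Rightarrow> 'm \<Rightarrow> 'm) \<Rightarrow> ('v \<Rightarrow> 'b \<Rightarrow> 'm) \<Rightarrow>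
   ('a, 'v, 'b, 'm) cochain2 \<Rightarrow> ('a, 'v, 'b, 'm) cochain2 set"
  where "cohomology_class \<A> \<B> rB rM \<mu> z = cohomologous \<A> \<B> rB rM \<mu> `` {z}"

definition wells_cochain ::
  "('k, 'a, 'v) rel_rb \<Rightarrow>
   ('k, 'a, 'v, 'b::ab_group_add, 'm::ab_group_add, 'c::ab_group_add, 'w::ab_group_add) extension \<Rightarrow>
   ('a \<Rightarrow> 'c) \<Rightarrow> ('v \<Rightarrow> 'w) \<Rightarrow> (('a \<Rightarrow> 'a) \<times> ('v \<Rightarrow> 'v)) \<times> (('b \<Rightarrow> 'b) \<times> ('m \<Rightarrow> 'm)) \<Rightarrow>
   ('a, 'v, 'b, 'm) cochain2"
  where "wells_cochain \<A> \<E> sA sV = (\<lambda>((dA, dV), (dB, dM)).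
    (\<lambda>x y. dB (omega \<A> \<E> sA x y) - omega \<A> \<E> sA (dA x) y - omega \<A> \<E> sA x (dA y),
     \<lambda>x v. dM (varpi \<A> \<E> sA sV x v) - varpi \<A> \<E> sA sV (dA x) v - varpi \<A> \<E> sA sV x (dV v),
     \<lambda>v. dB (chi \<A> \<E> sA sV v) - chi \<A> \<E> sA sV (dV v)))"

definition wells_map ::
  "('k::field, 'a::ab_group_add, 'v::ab_group_add) rel_rb \<Rightarrow>
   ('k, 'b::ab_group_add, 'm::ab_group_add) rel_rb \<Rightarrow>
   ('k, 'a, 'v, 'b, 'm, 'c::ab_group_add, 'w::ab_group_add) extension \<Rightarrow>
   ('a \<Rightarrow> 'c) \<Rightarrow> ('v \<Rightarrow> 'w) \<Rightarrow> (('a \<Rightarrow> 'a) \<times> ('v \<Rightarrow> 'v)) \<times> (('b \<Rightarrow> 'b) \<times> ('m \<Rightarrow> 'm)) \<Rightarrow>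
   ('a, 'v, 'b, 'm) cochain2 set"
  where "wells_map \<A> \<B> \<E> sA sV d =
    cohomology_class \<A> \<B> (rho_B \<E> sA) (rho_M \<E> sA) (mu \<E> sV) (wells_cochain \<A> \<E> sA sV d)"

definition Der_preserving ::
  "('k::field, 'a, 'v, 'b, 'm, 'c::ab_group_add, 'w::ab_group_add) extension \<Rightarrow>
   (('c \<Rightarrow> 'c) \<times> ('w \<Rightarrow> 'w)) set"
  where "Der_preserving \<E> = {(D, D'). (D, D') \<in> Der (total \<E>) \<and>
    D ` range (inc_alg \<E>) \<subseteq> range (inc_alg \<E>) \<and>
    D' ` range (inc_mod \<E>) \<subseteq> range (inc_mod \<E>)}"

definition inducible ::
  "('k::field, 'a, 'v, 'b, 'm, 'c::ab_group_add, 'w::ab_group_add) extension \<Rightarrow>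
   ('a \<Rightarrow> 'c) \<Rightarrow> ('v \<Rightarrow> 'w) \<Rightarrow> (('a \<Rightarrow> 'a) \<times> ('v \<Rightarrow> 'v)) \<times> (('b \<Rightarrow> 'b) \<times> ('m \<Rightarrow> 'm)) \<Rightarrow> bool"
  where "inducible \<E> sA sV = (\<lambda>((dA, dV), (dB, dM)). \<exists>(D, D') \<in> Der_preserving \<E>.
    dA = proj_alg \<E> \<circ> D \<circ> sA \<and> dV = proj_mod \<E> \<circ> D' \<circ> sV \<and>
    D \<circ> inc_alg \<E> = inc_alg \<E> \<circ> dB \<and> D' \<circ> inc_mod \<E> = inc_mod \<E> \<circ> dM)"

end

theory Submission
  imports Defs
begin

text \<open>
  The section splits the middle term of the extension as \<open>sA A \<oplus> B\<close> and \<open>sV V \<oplus> M\<close>. A pair of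
  linear maps preserving \<open>B\<close> and \<open>M\<close> that induces \<open>(dA, dV)\<close> and \<open>(dB, dM)\<close> is triangular for this
  splitting: \<open>D (sA x + a) = sA (dA x) + \<phi>B x + dB a\<close> and \<open>D' (sV v + m) = sV (dV v) + \<phi>M v + dM m\<close>
  with linear maps \<open>\<phi>B\<close> and \<open>\<phi>M\<close>. Comparing the components of the derivation
  identities on \<open>B\<close> and \<open>M\<close> gives the compatibility conditions, and comparing them on the image of
  the section says exactly that the Wells cochain is the coboundary of \<open>(\<phi>B, \<phi>M)\<close>.
\<close>

section \<open>Linear and bilinear maps over explicit scalar multiplications\<close>

lemma linear_simps:
  assumes "Vector_Spaces.linear s t f"
  shows "f (x + y) = f x + f y" and "f (x - y) = f x - f y" and "f (- x) = - f x"
    and "f 0 = 0" and "f (s c x) = t c (f x)"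
proof -
  interpret Vector_Spaces.linear s t f by (fact assms)
  show "f (x + y) = f x + f y" "f (x - y) = f x - f y" "f (- x) = - f x"
    "f 0 = 0" "f (s c x) = t c (f x)"
    by (rule add diff neg zero scale)+
qed

lemma bilinear_map_simps:
  assumes "bilinear_map sa sb sc f"
  shows "f (x + x') y = f x y + f x' y" and "f (x - x') y = f x y - f x' y"
    and "f (- x) y = - f x y" and "f 0 y = 0" and "f (sa c x) y = sc c (f x y)"
    and "f x (y + y') = f x y + f x y'" and "f x (y - y') = f x y - f x y'"
    and "f x (- y) = - f x y" and "f x 0 = 0" and "f x (sb c y) = sc c (f x y)"
proof -
  have l: "Vector_Spaces.linear sa sc (\<lambda>x. f x y)" and r: "Vector_Spaces.linear sb sc (f x)" for x y
    using assms by (auto simp: bilinear_map_def)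
  show "f (x + x') y = f x y + f x' y" "f (x - x') y = f x y - f x' y"
    "f (- x) y = - f x y" "f 0 y = 0" "f (sa c x) y = sc c (f x y)"
    by (rule linear_simps[OF l])+
  show "f x (y + y') = f x y + f x y'" "f x (y - y') = f x y - f x y'"
    "f x (- y) = - f x y" "f x 0 = 0" "f x (sb c y) = sc c (f x y)"
    by (rule linear_simps[OF r])+
qed

text \<open>The induced maps are defined by reading elements back through the inverse of an
  embedding. Injectivity lets their linearity be tested after composition with that embedding, where
  they become combinations of linear maps of the middle term.\<close>

lemma linear_of_inj_comp:
  assumes f: "Vector_Spaces.linear sb sc f" and "inj f"
    and g: "Vector_Spaces.linear sa sc (\<lambda>x. f (g x))"
  shows "Vector_Spaces.linear sa sb g"
proof -
  have "f (g (x + y)) = f (g x + g y)" "f (g (sa c x)) = f (sb c (g x))" for x y c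
    by (simp_all only: linear_simps[OF f] linear_simps[OF g])
  then show ?thesis
    using f g \<open>inj f\<close> by (simp add: Vector_Spaces.linear_iff inj_eq)
qed

lemma lie_algebra_antisym:
  assumes "lie_algebra s br"
  shows "br x y = - br y x"
proof -
  have b: "bilinear_map s s s br" and alt: "br z z = 0" for z
    using assms by (auto simp: lie_algebra_def)
  have "br (x + y) (x + y) = br x x + br x y + br y x + br y y"
    by (simp only: bilinear_map_simps[OF b] ac_simps)
  then show ?thesis by (simp add: alt eq_neg_iff_add_eq_0)
qed

section \<open>An abelian extension with a fixed section\<close>

locale abelian_extension_section =
  fixes \<A> :: "('k::field, 'a::ab_group_add, 'v::ab_group_add) rel_rb"
    and \<B> :: "('k, 'b::ab_group_add, 'm::ab_group_add) rel_rb"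
    and \<E> :: "('k, 'a, 'v, 'b, 'm, 'c::ab_group_add, 'w::ab_group_add) extension"
    and sA :: "'a \<Rightarrow> 'c" and sV :: "'v \<Rightarrow> 'w"
  assumes extension: "abelian_extension \<A> \<B> \<E>"
    and sect: "is_section \<A> \<E> sA sV"
begin

abbreviation "rB \<equiv> rho_B \<E> sA"
abbreviation "rM \<equiv> rho_M \<E> sA"
abbreviation "\<mu> \<equiv> mu \<E> sV"
abbreviation "\<omega> \<equiv> omega \<A> \<E> sA"
abbreviation "\<pi> \<equiv> varpi \<A> \<E> sA sV"
abbreviation "\<chi> \<equiv> chi \<A> \<E> sA sV"
abbreviation "i \<equiv> inc_alg \<E>"
abbreviation "j \<equiv> inc_mod \<E>"
abbreviation "p \<equiv> proj_alg \<E>"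
abbreviation "q \<equiv> proj_mod \<E>"
abbreviation "br \<equiv> bracket \<A>"
abbreviation "act \<equiv> action \<A>"
abbreviation "T \<equiv> rb_op \<A>"
abbreviation "S \<equiv> rb_op \<B>"
abbreviation "hbr \<equiv> bracket (total \<E>)"
abbreviation "hact \<equiv> action (total \<E>)"
abbreviation "hT \<equiv> rb_op (total \<E>)"
abbreviation "scA \<equiv> alg_scale \<A>"
abbreviation "scV \<equiv> mod_scale \<A>"
abbreviation "scB \<equiv> alg_scale \<B>"
abbreviation "scM \<equiv> mod_scale \<B>"
abbreviation "hscA \<equiv> alg_scale (total \<E>)"
abbreviation "hscV \<equiv> mod_scale (total \<E>)"

lemma linear_maps:
  shows linear_i: "Vector_Spaces.linear scB hscA i"
    and linear_j: "Vector_Spaces.linear scM hscV j"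
    and linear_p: "Vector_Spaces.linear hscA scA p"
    and linear_q: "Vector_Spaces.linear hscV scV q"
    and linear_sA: "Vector_Spaces.linear scA hscA sA"
    and linear_sV: "Vector_Spaces.linear scV hscV sV"
    and linear_T: "Vector_Spaces.linear scV scA T"
    and linear_S: "Vector_Spaces.linear scM scB S"
    and linear_hT: "Vector_Spaces.linear hscV hscA hT"
  using extension sect
  by (auto simp: abelian_extension_def is_section_def rel_rb_hom_def rel_rb_lie_algebra_def)

lemma bilinear_maps:
  shows bilinear_br: "bilinear_map scA scA scA br"
    and bilinear_act: "bilinear_map scA scV scV act"
    and bilinear_hbr: "bilinear_map hscA hscA hscA hbr"
    and bilinear_hact: "bilinear_map hscA hscV hscV hact"
  using extension
  by (auto simp: abelian_extension_def rel_rb_lie_algebra_def lie_algebra_def lie_representation_def)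

lemma vector_spaces:
  shows "vector_space scA" "vector_space scV" "vector_space scB" "vector_space scM"
    "vector_space hscA" "vector_space hscV"
  using linear_maps by (auto simp: Vector_Spaces.linear_iff)

lemmas modules = vector_spaces[folded module_iff_vector_space]

lemmas lin = linear_maps[THEN linear_simps(1)] linear_maps[THEN linear_simps(2)]
  linear_maps[THEN linear_simps(3)] linear_maps[THEN linear_simps(4)]

lemmas lin_scale = linear_maps[THEN linear_simps(5)]

lemmas bilin = bilinear_map_simps[OF bilinear_br] bilinear_map_simps[OF bilinear_act]
  bilinear_map_simps[OF bilinear_hbr] bilinear_map_simps[OF bilinear_hact]

lemma inj_i: "inj i" and inj_j: "inj j"
  using extension by (auto simp: abelian_extension_def)

lemma i_eq_iff [simp]: "i a = i b \<longleftrightarrow> a = b" and j_eq_iff [simp]: "j m = j n \<longleftrightarrow> m = n"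
  using inj_i inj_j by (auto simp: inj_eq)

lemma range_i: "range i = {c. p c = 0}" and range_j: "range j = {w. q w = 0}"
  using extension by (auto simp: abelian_extension_def)

lemma p_i [simp]: "p (i a) = 0" and q_j [simp]: "q (j m) = 0"
  using range_i range_j by auto

lemma p_sA [simp]: "p (sA x) = x" and q_sV [simp]: "q (sV v) = v"
  using sect by (auto simp: is_section_def fun_eq_iff)

lemma i_inv: "p c = 0 \<Longrightarrow> i (inv i c) = c" and j_inv: "q w = 0 \<Longrightarrow> j (inv j w) = w"
  using range_i range_j by (auto intro!: f_inv_into_f)

lemma proj_hom:
  "p (hbr c c') = br (p c) (p c')" "q (hact c w) = act (p c) (q w)" "p (hT w) = T (q w)"
  using extension by (auto simp: abelian_extension_def rel_rb_hom_def)

lemma hbr_antisym: "hbr c c' = - hbr c' c" and br_antisym: "br x y = - br y x"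
  using extension
  by (auto simp: abelian_extension_def rel_rb_lie_algebra_def intro: lie_algebra_antisym)

lemma br_self [simp]: "br x x = 0"
  using extension by (auto simp: abelian_extension_def rel_rb_lie_algebra_def lie_algebra_def)

lemma hbr_jacobi: "hbr c (hbr c' c'') + hbr c' (hbr c'' c) + hbr c'' (hbr c c') = 0"
  using extension by (auto simp: abelian_extension_def rel_rb_lie_algebra_def lie_algebra_def)

lemma br_jacobi: "br c (br c' c'') + br c' (br c'' c) + br c'' (br c c') = 0"
  using extension by (auto simp: abelian_extension_def rel_rb_lie_algebra_def lie_algebra_def)

lemma hact_br: "hact (hbr c c') w = hact c (hact c' w) - hact c' (hact c w)"
  and act_br: "act (br x y) v = act x (act y v) - act y (act x v)"
  using extension
  by (auto simp: abelian_extension_def rel_rb_lie_algebra_def lie_representation_def)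

lemma hT_rota_baxter: "hbr (hT w) (hT w') = hT (hact (hT w) w' - hact (hT w') w)"
  and T_rota_baxter: "br (T u) (T v) = T (act (T u) v - act (T v) u)"
  using extension by (auto simp: abelian_extension_def rel_rb_lie_algebra_def)

section \<open>Components of the structure maps of the middle term in the splitting\<close>

lemma hbr_split:
  "hbr (sA x) (sA y) = sA (br x y) + i (\<omega> x y)"
  "hbr (sA x) (i a) = i (rB x a)"
  "hbr (i a) (sA x) = - i (rB x a)"
  "hbr (i a) (i b) = 0"
proof -
  \<comment> \<open>Since \<open>p\<close> is a homomorphism with \<open>p (sA x) = x\<close>, the
    argument of \<open>inv i\<close> lies in the kernel of \<open>p\<close>, so \<open>i_inv\<close>
    removes the inverse. All later computations with \<omega>, \<open>rB\<close> and their analogues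
    go through the \<open>split\<close> equations.\<close>
  show "hbr (sA x) (sA y) = sA (br x y) + i (\<omega> x y)"
    by (simp add: omega_def i_inv lin proj_hom)
  show *: "hbr (sA x) (i a) = i (rB x a)"
    by (simp add: rho_B_def i_inv proj_hom bilin)
  show "hbr (i a) (sA x) = - i (rB x a)"
    by (subst hbr_antisym) (simp add: *)
  have "hbr (i a) (i b) = i (bracket \<B> a b)" "bracket \<B> a b = 0"
    using extension by (auto simp: abelian_extension_def rel_rb_hom_def rel_rb_abelian_def)
  then show "hbr (i a) (i b) = 0" by (simp add: lin)
qed

lemma hact_split:
  "hact (sA x) (sV v) = sV (act x v) + j (\<pi> x v)"
  "hact (sA x) (j m) = j (rM x m)"
  "hact (i a) (sV v) = - j (\<mu> v a)"
  "hact (i a) (j m) = 0"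
proof -
  show "hact (sA x) (sV v) = sV (act x v) + j (\<pi> x v)"
    by (simp add: varpi_def j_inv lin proj_hom)
  show "hact (sA x) (j m) = j (rM x m)"
    by (simp add: rho_M_def j_inv proj_hom bilin)
  show "hact (i a) (sV v) = - j (\<mu> v a)"
    by (simp add: mu_def j_inv proj_hom bilin lin)
  \<comment> \<open>Here the kernel enters as an abelian object: it acts trivially on itself, which
    kills the products of correction terms with kernel elements in every later comparison.\<close>
  have "hact (i a) (j m) = j (action \<B> a m)" "action \<B> a m = 0"
    using extension by (auto simp: abelian_extension_def rel_rb_hom_def rel_rb_abelian_def)
  then show "hact (i a) (j m) = 0" by (simp add: lin)
qed

lemma hT_split:
  "hT (sV v) = sA (T v) + i (\<chi> v)"
  "hT (j m) = i (S m)"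
proof -
  show "hT (sV v) = sA (T v) + i (\<chi> v)"
    by (simp add: chi_def i_inv lin proj_hom)
  show "hT (j m) = i (S m)"
    using extension by (auto simp: abelian_extension_def rel_rb_hom_def)
qed

lemmas split = hbr_split hact_split hT_split

section \<open>The induced coefficients and their identities\<close>

lemma bilinear_rB: "bilinear_map scA scB scB rB"
  and bilinear_rM: "bilinear_map scA scM scM rM"
  and bilinear_mu: "bilinear_map scV scB scM \<mu>"
proof -
  \<comment> \<open>For \<open>rB\<close> and \<open>rM\<close> the reversed \<open>split\<close>
    equations express values by the bracket and action of the middle term, so bilinearity is
    inherited. The sign in the definition of \<mu> calls for this separate form.\<close>
  have *: "j (\<mu> v a) = - hact (i a) (sV v)" for v a by (simp add: split)
  show "bilinear_map scA scB scB rB"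
    unfolding bilinear_map_def
    by (intro conjI allI linear_of_inj_comp[OF linear_i inj_i];
        simp add: Vector_Spaces.linear_iff vector_spaces lin lin_scale bilin flip: split)
  show "bilinear_map scA scM scM rM"
    unfolding bilinear_map_def
    by (intro conjI allI linear_of_inj_comp[OF linear_j inj_j];
        simp add: Vector_Spaces.linear_iff vector_spaces lin lin_scale bilin flip: split)
  show "bilinear_map scV scB scM \<mu>"
    unfolding bilinear_map_def
    by (intro conjI allI linear_of_inj_comp[OF linear_j inj_j];
        simp add: * Vector_Spaces.linear_iff vector_spaces lin lin_scale bilin
          modules[THEN module.scale_minus_right])
qed

lemmas induced_bilin = bilinear_map_simps[OF bilinear_rB] bilinear_map_simps[OF bilinear_rM]
  bilinear_map_simps[OF bilinear_mu]

text \<open>This identity and the next three are the compatibilities of the coefficients. Each is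
  the kernel component of an axiom of the middle term with one argument in the kernel and the others
  in the image of the section; the corrections \<omega>, \<pi> and \<chi> drop out because kernel
  elements act trivially on the kernel.\<close>

lemma rB_br: "rB (br x y) a = rB x (rB y a) - rB y (rB x a)"
proof -
  have "i (rB (br x y) a) = i (rB x (rB y a) - rB y (rB x a))"
    using hbr_jacobi[of "sA x" "sA y" "i a"]
    by (simp add: split bilin lin algebra_simps)
  then show ?thesis by simp
qed

lemma rM_br: "rM (br x y) m = rM x (rM y m) - rM y (rM x m)"
proof -
  have "j (rM (br x y) m) = j (rM x (rM y m) - rM y (rM x m))"
    using hact_br[of "sA x" "sA y" "j m"]
    by (simp add: split bilin lin algebra_simps)
  then show ?thesis by simp
qed

lemma mu_rB: "\<mu> v (rB x a) = rM x (\<mu> v a) - \<mu> (act x v) a"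
proof -
  have "j (\<mu> v (rB x a)) = j (rM x (\<mu> v a) - \<mu> (act x v) a)"
    using hact_br[of "sA x" "i a" "sV v"]
    by (simp add: split bilin lin algebra_simps)
  then show ?thesis by simp
qed

lemma rB_T_S: "rB (T v) (S m) = S (rM (T v) m + \<mu> v (S m))"
proof -
  have "i (rB (T v) (S m)) = i (S (rM (T v) m + \<mu> v (S m)))"
    using hT_rota_baxter[of "sV v" "j m"]
    by (simp add: split bilin lin algebra_simps)
  then show ?thesis by simp
qed

section \<open>Coboundaries and the zero cohomology class\<close>

lemma B2_subset_Z2: "B2 \<A> \<B> rB rM \<mu> \<subseteq> Z2 \<A> \<B> rB rM \<mu>"
proof
  fix z assume "z \<in> B2 \<A> \<B> rB rM \<mu>"
  then obtain \<phi>B \<phi>M where z: "z = coboundary \<A> \<B> rB rM \<mu> \<phi>B \<phi>M"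
    and lB: "Vector_Spaces.linear scA scB \<phi>B" and lM: "Vector_Spaces.linear scV scM \<phi>M"
    unfolding B2_def by blast
  note \<phi> = linear_simps[OF lB] linear_simps[OF lM]
  have B: "bilinear_map scA scA scB (\<lambda>x y. rB x (\<phi>B y) - rB y (\<phi>B x) - \<phi>B (br x y))"
    unfolding bilinear_map_def
    by (simp add: Vector_Spaces.linear_iff vector_spaces lin lin_scale bilin induced_bilin \<phi>
        algebra_simps modules[THEN module.scale_right_diff_distrib]
        modules[THEN module.scale_right_distrib])
  have M: "bilinear_map scA scV scM (\<lambda>x v. - \<mu> v (\<phi>B x) + rM x (\<phi>M v) - \<phi>M (act x v))"
    unfolding bilinear_map_def
    by (simp add: Vector_Spaces.linear_iff vector_spaces lin lin_scale bilin induced_bilin \<phi>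
        algebra_simps modules[THEN module.scale_right_diff_distrib]
        modules[THEN module.scale_right_distrib] modules[THEN module.scale_minus_right])
  have L: "Vector_Spaces.linear scV scB (\<lambda>v. - \<phi>B (T v) + S (\<phi>M v))"
    by (simp add: Vector_Spaces.linear_iff vector_spaces lin lin_scale \<phi>
        algebra_simps modules[THEN module.scale_right_diff_distrib]
        modules[THEN module.scale_right_distrib] modules[THEN module.scale_minus_right])
  \<comment> \<open>In the first cocycle condition the terms with \<open>rB\<close> cancel by
    \<open>rB_br\<close>. What remains is \<open>\<phi>B\<close> on iterated brackets, which
    vanishes by the Jacobi identity once antisymmetry has brought it to the bracketing found
    there.\<close>
  have J: "\<phi>B (br x (br y z)) - \<phi>B (br y (br x z)) + \<phi>B (br z (br x y)) = 0" for x y z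
    using arg_cong[OF br_jacobi[of x y z], of \<phi>B] br_antisym[of z x]
    by (simp add: \<phi> bilin)
  have 1: "- \<phi>B (br (br x y) z) + \<phi>B (br (br x z) y) - \<phi>B (br (br y z) x) = 0" for x y z
    using J[of x y z] br_antisym[of "br x y" z] br_antisym[of "br x z" y] br_antisym[of "br y z" x]
    by (simp add: \<phi> algebra_simps)
  show "z \<in> Z2 \<A> \<B> rB rM \<mu>"
    unfolding z Z2_def coboundary_def Let_def mem_Collect_eq prod.case
  proof (intro conjI allI B M L)
    show "rB x (\<phi>B x) - rB x (\<phi>B x) - \<phi>B (br x x) = 0" for x
      by (simp add: \<phi>)
  next
    fix x y z
    show "rB x (rB y (\<phi>B z) - rB z (\<phi>B y) - \<phi>B (br y z)) -
        rB y (rB x (\<phi>B z) - rB z (\<phi>B x) - \<phi>B (br x z)) +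
        rB z (rB x (\<phi>B y) - rB y (\<phi>B x) - \<phi>B (br x y)) -
        (rB (br x y) (\<phi>B z) - rB z (\<phi>B (br x y)) - \<phi>B (br (br x y) z)) +
        (rB (br x z) (\<phi>B y) - rB y (\<phi>B (br x z)) - \<phi>B (br (br x z) y)) -
        (rB (br y z) (\<phi>B x) - rB x (\<phi>B (br y z)) - \<phi>B (br (br y z) x)) = 0"
      using 1[of x y z] by (simp add: induced_bilin rB_br \<phi> algebra_simps)
  \<comment> \<open>The second condition rests on \<open>rM_br\<close>, \<open>mu_rB\<close> and
    \<open>act_br\<close>. In the third, \<open>rB_T_S\<close> cancels the terms in
    \<open>S (\<phi>M v)\<close>, and \<open>T_rota_baxter\<close> those where
    \<open>\<phi>B\<close> meets a bracket.\<close>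
  qed (simp_all add: induced_bilin rM_br mu_rB act_br rB_T_S T_rota_baxter \<phi> lin algebra_simps)
qed

lemma B2_diff:
  assumes "z \<in> B2 \<A> \<B> rB rM \<mu>" and "z' \<in> B2 \<A> \<B> rB rM \<mu>"
  shows "z - z' \<in> B2 \<A> \<B> rB rM \<mu>"
proof -
  obtain \<phi>B \<phi>M where z: "z = coboundary \<A> \<B> rB rM \<mu> \<phi>B \<phi>M"
    and l: "Vector_Spaces.linear scA scB \<phi>B" "Vector_Spaces.linear scV scM \<phi>M"
    using assms(1) unfolding B2_def by blast
  obtain \<psi>B \<psi>M where z': "z' = coboundary \<A> \<B> rB rM \<mu> \<psi>B \<psi>M"
    and l': "Vector_Spaces.linear scA scB \<psi>B" "Vector_Spaces.linear scV scM \<psi>M"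
    using assms(2) unfolding B2_def by blast
  have "z - z' = coboundary \<A> \<B> rB rM \<mu> (\<lambda>x. \<phi>B x - \<psi>B x) (\<lambda>v. \<phi>M v - \<psi>M v)"
    unfolding z z' coboundary_def
    by (simp add: fun_eq_iff induced_bilin lin algebra_simps)
  moreover have "Vector_Spaces.linear scA scB (\<lambda>x. \<phi>B x - \<psi>B x)"
    "Vector_Spaces.linear scV scM (\<lambda>v. \<phi>M v - \<psi>M v)"
    using l l' vector_spaces
    by (auto intro!: vector_space_pair.linear_compose_sub simp: vector_space_pair_def)
  ultimately show ?thesis unfolding B2_def by blast
qed

lemma zero_in_B2: "0 \<in> B2 \<A> \<B> rB rM \<mu>"
proof -
  have "0 = coboundary \<A> \<B> rB rM \<mu> (\<lambda>x. 0) (\<lambda>v. 0)"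
    by (simp add: coboundary_def fun_eq_iff induced_bilin lin zero_prod_def)
  moreover have "Vector_Spaces.linear scA scB (\<lambda>x. 0)" "Vector_Spaces.linear scV scM (\<lambda>v. 0)"
    using vector_spaces by (auto intro!: vector_space_pair.linear_zero simp: vector_space_pair_def)
  ultimately show ?thesis unfolding B2_def by blast
qed

text \<open>The relation \<open>cohomologous\<close> lives on \<open>Z2\<close>, so a cochain
  outside \<open>Z2\<close> has the empty class, whereas the class of 0 contains 0. Equality of the
  classes therefore already forces \<open>z - 0\<close> into \<open>B2\<close>, for an arbitrary
  cochain \<open>z\<close>.\<close>

lemma cohomology_class_eq_zero_iff:
  "cohomology_class \<A> \<B> rB rM \<mu> z = cohomology_class \<A> \<B> rB rM \<mu> 0 \<longleftrightarrow> z \<in> B2 \<A> \<B> rB rM \<mu>"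
  (is "?C z = ?C 0 \<longleftrightarrow> z \<in> ?B2")
proof
  have "0 \<in> ?C 0"
    using zero_in_B2 B2_subset_Z2 by (auto simp: cohomology_class_def cohomologous_def)
  moreover assume "?C z = ?C 0"
  ultimately have "0 \<in> ?C z" by blast
  then show "z \<in> ?B2"
    by (auto simp: cohomology_class_def cohomologous_def)
next
  assume z: "z \<in> ?B2"
  \<comment> \<open>Closure under differences suffices in both directions: \<open>0 - w\<close> is
    \<open>(z - w) - z\<close>, and \<open>z - w\<close> is
    \<open>z - (0 - (0 - w))\<close>.\<close>
  have "z - w \<in> ?B2 \<longleftrightarrow> 0 - w \<in> ?B2" for w
    using B2_diff[OF _ z, of "z - w"] B2_diff[OF z B2_diff[OF zero_in_B2, of "0 - w"]] by auto
  then show "?C z = ?C 0"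
    using z zero_in_B2 B2_subset_Z2 by (auto simp: cohomology_class_def cohomologous_def)
qed

section \<open>Decomposition of the middle term and necessity of the two conditions\<close>

lemma decompose_alg: obtains x a where "c = sA x + i a"
proof
  show "c = sA (p c) + i (inv i (c - sA (p c)))" by (simp add: i_inv lin)
qed

lemma decompose_mod: obtains v m where "w = sV v + j m"
proof
  show "w = sV (q w) + j (inv j (w - sV (q w)))" by (simp add: j_inv lin)
qed

lemma compatible_and_wells_coboundary_if_inducible:
  assumes d: "(dA, dV) \<in> Der \<A>" "(dB, dM) \<in> End \<B>"
    and ind: "inducible \<E> sA sV ((dA, dV), (dB, dM))"
  shows "((dA, dV), (dB, dM)) \<in> compatible_pairs \<A> \<B> rB rM \<mu> \<and>
    wells_cochain \<A> \<E> sA sV ((dA, dV), (dB, dM)) \<in> B2 \<A> \<B> rB rM \<mu>"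
proof -
  obtain D D' where DD: "(D, D') \<in> Der (total \<E>)"
    and dA: "dA x = p (D (sA x))" and dV: "dV v = q (D' (sV v))"
    and Di: "D (i a) = i (dB a)" and D'j: "D' (j m) = j (dM m)" for x v a m
    using ind by (auto simp: inducible_def Der_preserving_def fun_eq_iff)
  from DD have lD: "Vector_Spaces.linear hscA hscA D" and lD': "Vector_Spaces.linear hscV hscV D'"
    and D_br: "D (hbr c c') = hbr (D c) c' + hbr c (D c')"
    and D_T: "hT (D' w) = D (hT w)"
    and D_act: "D' (hact c w) = hact c (D' w) + hact (D c) w" for c c' w
    by (auto simp: Der_def)
  from d have ldA: "Vector_Spaces.linear scA scA dA" and ldV: "Vector_Spaces.linear scV scV dV"
    and dA_br: "dA (br x y) = br (dA x) y + br x (dA y)"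
    and dT: "T (dV v) = dA (T v)"
    and d_act: "dV (act x v) = act x (dV v) + act (dA x) v" for x y v
    by (auto simp: Der_def)
  note D_lin = linear_simps[OF lD] linear_simps[OF lD']
  note d_lin = linear_simps[OF ldA] linear_simps[OF ldV]
  \<comment> \<open>The cochain witnessing the coboundary is the failure of \<open>D\<close> and
    \<open>D'\<close> to commute with the section. It takes values in the kernel because
    \<open>dA\<close> and \<open>dV\<close> are the maps induced on the quotient.\<close>
  define \<phi>B where "\<phi>B x = inv i (D (sA x) - sA (dA x))" for x
  define \<phi>M where "\<phi>M v = inv j (D' (sV v) - sV (dV v))" for v
  have i_phi: "i (\<phi>B x) = D (sA x) - sA (dA x)" for x
    by (simp add: \<phi>B_def i_inv lin dA)
  have j_phi: "j (\<phi>M v) = D' (sV v) - sV (dV v)" for v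
    by (simp add: \<phi>M_def j_inv lin dV)
  have Ds: "D (sA x) = sA (dA x) + i (\<phi>B x)" "D' (sV v) = sV (dV v) + j (\<phi>M v)" for x v
    by (simp_all add: i_phi j_phi)
  have "Vector_Spaces.linear scA scB \<phi>B"
    by (rule linear_of_inj_comp[OF linear_i inj_i])
      (simp add: i_phi Vector_Spaces.linear_iff vector_spaces lin lin_scale D_lin d_lin
        modules[THEN module.scale_right_diff_distrib])
  moreover have "Vector_Spaces.linear scV scM \<phi>M"
    by (rule linear_of_inj_comp[OF linear_j inj_j])
      (simp add: j_phi Vector_Spaces.linear_iff vector_spaces lin lin_scale D_lin d_lin
        modules[THEN module.scale_right_diff_distrib])
  moreover have "wells_cochain \<A> \<E> sA sV ((dA, dV), (dB, dM)) = coboundary \<A> \<B> rB rM \<mu> \<phi>B \<phi>M"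
  proof -
    \<comment> \<open>Evaluated on the image of the section, the derivation identity has a section
      part, which cancels because \<open>(dA, dV)\<close> is a derivation of \<A>, and a kernel
      part, which is the claimed equation.\<close>
    have "i (dB (\<omega> x y) - \<omega> (dA x) y - \<omega> x (dA y)) = i (rB x (\<phi>B y) - rB y (\<phi>B x) - \<phi>B (br x y))"
      for x y
      using D_br[of "sA x" "sA y"]
      by (simp add: split Ds Di D_lin lin bilin dA_br algebra_simps)
    moreover have "j (dM (\<pi> x v) - \<pi> (dA x) v - \<pi> x (dV v))
        = j (- \<mu> v (\<phi>B x) + rM x (\<phi>M v) - \<phi>M (act x v))" for x v
      using D_act[of "sA x" "sV v"]
      by (simp add: split Ds D'j D_lin lin bilin d_act algebra_simps)
    moreover have "i (dB (\<chi> v) - \<chi> (dV v)) = i (- \<phi>B (T v) + S (\<phi>M v))" for v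
      using D_T[of "sV v"]
      by (simp add: split Ds Di D_lin lin bilin dT algebra_simps)
    ultimately show ?thesis
      by (simp add: wells_cochain_def coboundary_def fun_eq_iff)
  qed
  moreover have "((dA, dV), (dB, dM)) \<in> compatible_pairs \<A> \<B> rB rM \<mu>"
  proof -
    \<comment> \<open>With one argument in the kernel, \<open>\<phi>B\<close> and
      \<open>\<phi>M\<close> occur only in products of two kernel elements and so disappear; only
      the diagonal parts of \<open>D\<close> and \<open>D'\<close> are left.\<close>
    have "j (dM (rM x m)) = j (rM x (dM m) + rM (dA x) m)" for x m
      using D_act[of "sA x" "j m"] by (simp add: split Ds D'j lin bilin)
    moreover have "i (dB (rB x a)) = i (rB x (dB a) + rB (dA x) a)" for x a
      using D_br[of "sA x" "i a"] by (simp add: split Ds Di lin bilin add.commute)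
    moreover have "j (dM (\<mu> v a)) = j (\<mu> (dV v) a + \<mu> v (dB a))" for v a
      using D_act[of "i a" "sV v"]
      by (simp add: split Ds Di D'j D_lin lin bilin algebra_simps)
    moreover have "i (dB (S m)) = i (S (dM m))" for m
      using D_T[of "j m"] by (simp add: split Di D'j)
    ultimately show ?thesis
      using d by (simp add: compatible_pairs_def)
  qed
  ultimately show ?thesis unfolding B2_def by blast
qed

section \<open>Construction of an inducing derivation\<close>

lemma inducible_if_wells_coboundary:
  assumes compat: "((dA, dV), (dB, dM)) \<in> compatible_pairs \<A> \<B> rB rM \<mu>"
    and wells: "wells_cochain \<A> \<E> sA sV ((dA, dV), (dB, dM)) \<in> B2 \<A> \<B> rB rM \<mu>"
  shows "inducible \<E> sA sV ((dA, dV), (dB, dM))"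
proof -
  from compat have ldA: "Vector_Spaces.linear scA scA dA" and ldV: "Vector_Spaces.linear scV scV dV"
    and dA_br: "dA (br x y) = br (dA x) y + br x (dA y)"
    and dT: "T (dV v) = dA (T v)"
    and d_act: "dV (act x v) = act x (dV v) + act (dA x) v"
    and ldB: "Vector_Spaces.linear scB scB dB" and ldM: "Vector_Spaces.linear scM scM dM"
    and d_rM: "dM (rM x m) = rM x (dM m) + rM (dA x) m"
    and d_rB: "dB (rB x a) = rB x (dB a) + rB (dA x) a"
    and d_mu: "dM (\<mu> v a) = \<mu> (dV v) a + \<mu> v (dB a)"
    and d_S: "dB (S m) = S (dM m)" for x y v a m
    by (auto simp: compatible_pairs_def Der_def End_def)
  from wells obtain \<phi>B \<phi>M where lB: "Vector_Spaces.linear scA scB \<phi>B"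
    and lM: "Vector_Spaces.linear scV scM \<phi>M"
    and eq: "wells_cochain \<A> \<E> sA sV ((dA, dV), (dB, dM)) = coboundary \<A> \<B> rB rM \<mu> \<phi>B \<phi>M"
    unfolding B2_def by blast
  \<comment> \<open>Solved for the values of \<open>dB\<close> and \<open>dM\<close>, the components
    of the coboundary equation can be used as rewrite rules alongside the compatibility
    conditions.\<close>
  have d_omega: "dB (\<omega> x y) = \<omega> (dA x) y + \<omega> x (dA y) + (rB x (\<phi>B y) - rB y (\<phi>B x) - \<phi>B (br x y))"
    and d_varpi: "dM (\<pi> x v) = \<pi> (dA x) v + \<pi> x (dV v) + (- \<mu> v (\<phi>B x) + rM x (\<phi>M v) - \<phi>M (act x v))"
    and d_chi: "dB (\<chi> v) = \<chi> (dV v) + (- \<phi>B (T v) + S (\<phi>M v))" for x y v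
  proof -
    have "dB (\<omega> x y) - \<omega> (dA x) y - \<omega> x (dA y) = rB x (\<phi>B y) - rB y (\<phi>B x) - \<phi>B (br x y)"
      "dM (\<pi> x v) - \<pi> (dA x) v - \<pi> x (dV v) = - \<mu> v (\<phi>B x) + rM x (\<phi>M v) - \<phi>M (act x v)"
      "dB (\<chi> v) - \<chi> (dV v) = - \<phi>B (T v) + S (\<phi>M v)"
      using eq by (simp_all add: wells_cochain_def coboundary_def fun_eq_iff)
    then show "dB (\<omega> x y) = \<omega> (dA x) y + \<omega> x (dA y) + (rB x (\<phi>B y) - rB y (\<phi>B x) - \<phi>B (br x y))"
      "dM (\<pi> x v) = \<pi> (dA x) v + \<pi> x (dV v) + (- \<mu> v (\<phi>B x) + rM x (\<phi>M v) - \<phi>M (act x v))"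
      "dB (\<chi> v) = \<chi> (dV v) + (- \<phi>B (T v) + S (\<phi>M v))"
      by (metis (no_types, lifting) add.commute diff_add_cancel diff_diff_eq)+
  qed
  note d_lin = linear_simps[OF ldA] linear_simps[OF ldV] linear_simps[OF ldB] linear_simps[OF ldM]
    linear_simps[OF lB] linear_simps[OF lM]
  \<comment> \<open>The coordinates of \<open>c\<close> in the splitting are \<open>p c\<close> and
    \<open>inv i (c - sA (p c))\<close>. The given maps form the diagonal, and the cochain whose
    coboundary is the Wells cochain fills the off-diagonal entry.\<close>
  define D where "D c = sA (dA (p c)) + i (\<phi>B (p c)) + i (dB (inv i (c - sA (p c))))" for c
  define D' where "D' w = sV (dV (q w)) + j (\<phi>M (q w)) + j (dM (inv j (w - sV (q w))))" for w
  have D: "D (sA x + i a) = sA (dA x) + i (\<phi>B x) + i (dB a)" for x a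
    by (simp add: D_def lin inv_f_f[OF inj_i])
  have D': "D' (sV v + j m) = sV (dV v) + j (\<phi>M v) + j (dM m)" for v m
    by (simp add: D'_def lin inv_f_f[OF inj_j])
  have Ds: "D (sA x) = sA (dA x) + i (\<phi>B x)" "D (i a) = i (dB a)" for x a
    using D[of x 0] D[of 0 a] by (simp_all add: lin d_lin)
  have D's: "D' (sV v) = sV (dV v) + j (\<phi>M v)" "D' (j m) = j (dM m)" for v m
    using D'[of v 0] D'[of 0 m] by (simp_all add: lin d_lin)
  have D_add: "D (c + c') = D c + D c'" for c c'
  proof -
    obtain x a y b where c: "c = sA x + i a" "c' = sA y + i b"
      by (metis decompose_alg)
    have "D (sA (x + y) + i (a + b)) = D c + D c'"
      unfolding c D by (simp add: lin d_lin algebra_simps)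
    then show ?thesis by (simp add: c lin algebra_simps)
  qed
  have D'_add: "D' (w + w') = D' w + D' w'" for w w'
  proof -
    obtain x a y b where c: "w = sV x + j a" "w' = sV y + j b"
      by (metis decompose_mod)
    have "D' (sV (x + y) + j (a + b)) = D' w + D' w'"
      unfolding c D' by (simp add: lin d_lin algebra_simps)
    then show ?thesis by (simp add: c lin algebra_simps)
  qed
  note scale_add = modules[THEN module.scale_right_distrib]
  have lD: "Vector_Spaces.linear hscA hscA D"
  proof -
    have "D (hscA k c) = hscA k (D c)" for k c
    proof -
      obtain x a where c: "c = sA x + i a" by (rule decompose_alg)
      have "D (sA (scA k x) + i (scB k a)) = hscA k (D c)"
        unfolding c D by (simp add: lin_scale d_lin scale_add)
      then show ?thesis by (simp add: c lin_scale scale_add)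
    qed
    then show ?thesis by (simp add: Vector_Spaces.linear_iff vector_spaces D_add)
  qed
  have lD': "Vector_Spaces.linear hscV hscV D'"
  proof -
    have "D' (hscV k w) = hscV k (D' w)" for k w
    proof -
      obtain x a where c: "w = sV x + j a" by (rule decompose_mod)
      have "D' (sV (scV k x) + j (scM k a)) = hscV k (D' w)"
        unfolding c D' by (simp add: lin_scale d_lin scale_add)
      then show ?thesis by (simp add: c lin_scale scale_add)
    qed
    then show ?thesis by (simp add: Vector_Spaces.linear_iff vector_spaces D'_add)
  qed
  note D_lin = linear_simps[OF lD] linear_simps[OF lD']
  \<comment> \<open>By bilinearity this splits into cases: two section arguments give
    \<open>d_omega\<close> together with \<open>dA_br\<close>, a mixed pair gives
    \<open>d_rB\<close>, and for two kernel arguments both sides vanish. The identities for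
    \<open>hT\<close> and \<open>hact\<close> follow the same pattern.\<close>
  have "D (hbr c c') = hbr (D c) c' + hbr c (D c')" for c c'
  proof -
    obtain x a y b where c: "c = sA x + i a" "c' = sA y + i b"
      by (metis decompose_alg)
    show ?thesis
      by (simp add: c split Ds D_lin lin bilin d_lin dA_br d_rB d_omega algebra_simps)
  qed
  moreover have "hT (D' w) = D (hT w)" for w
  proof -
    obtain v m where w: "w = sV v + j m" by (rule decompose_mod)
    show ?thesis
      by (simp add: w split Ds D's D_lin lin d_lin dT d_S d_chi algebra_simps)
  qed
  moreover have "D' (hact c w) = hact c (D' w) + hact (D c) w" for c w
  proof -
    obtain x a v m where c: "c = sA x + i a" "w = sV v + j m"
      by (metis decompose_alg decompose_mod)
    show ?thesis
      by (simp add: c split Ds D's D_lin lin bilin d_lin d_act d_rM d_mu d_varpi algebra_simps)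
  qed
  ultimately have "(D, D') \<in> Der_preserving \<E>"
    using lD lD' by (auto simp: Der_preserving_def Der_def Ds D's)
  moreover have "dA = p \<circ> D \<circ> sA" "dV = q \<circ> D' \<circ> sV" "D \<circ> i = i \<circ> dB" "D' \<circ> j = j \<circ> dM"
    by (simp_all add: fun_eq_iff Ds D's lin)
  ultimately show ?thesis
    by (auto simp: inducible_def)
qed

end

section \<open>The criterion for inducibility\<close>

theorem theorem6p3:
  fixes \<A> :: "('k::field, 'a::ab_group_add, 'v::ab_group_add) rel_rb"
    and \<B> :: "('k, 'b::ab_group_add, 'm::ab_group_add) rel_rb"
    and \<E> :: "('k, 'a, 'v, 'b, 'm, 'c::ab_group_add, 'w::ab_group_add) extension"
    and sA :: "'a \<Rightarrow> 'c" and sV :: "'v \<Rightarrow> 'w"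
    and d :: "(('a \<Rightarrow> 'a) \<times> ('v \<Rightarrow> 'v)) \<times> (('b \<Rightarrow> 'b) \<times> ('m \<Rightarrow> 'm))"
  assumes "rel_rb_lie_algebra \<A>" and "rel_rb_lie_algebra \<B>"
    and "abelian_extension \<A> \<B> \<E>"
    and "is_section \<A> \<E> sA sV"
    and "d \<in> Der \<A> \<times> End \<B>"
  shows "inducible \<E> sA sV d \<longleftrightarrow>
    d \<in> compatible_pairs \<A> \<B> (rho_B \<E> sA) (rho_M \<E> sA) (mu \<E> sV) \<and>
    wells_map \<A> \<B> \<E> sA sV d =
      cohomology_class \<A> \<B> (rho_B \<E> sA) (rho_M \<E> sA) (mu \<E> sV) 0"
proof -
  interpret abelian_extension_section \<A> \<B> \<E> sA sV
    by unfold_locales (fact assms)+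
  obtain dA dV dB dM where d: "d = ((dA, dV), (dB, dM))"
    by (metis surj_pair)
  show ?thesis
    unfolding wells_map_def cohomology_class_eq_zero_iff d
    using assms(5) compatible_and_wells_coboundary_if_inducible[of dA dV dB dM]
      inducible_if_wells_coboundary[of dA dV dB dM]
    by (auto simp: d)
qed

end
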